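(* Let $A$ and $B$ be positive semidefinite matrices of the same size. For every real $\nu$ with $0\le\nu\le 1$, $$\operatorname{Tr}[B^2]+2\operatorname{Tr}[A^{1+\nu}B^{1-\nu}]\ \ge\ \operatorname{Tr}[A^{2\nu}B^{2(1-\nu)}]+2\operatorname{Tr}[AB].$$
   Context: Matrices are complex Hermitian positive semidefinite. Powers of positive semidefinite matrices are defined by functional calculus, with the convention $X^0=I$ (the identity matrix). *)

theory Defs
  imports "Jordan_Normal_Form.Schur_Decomposition"
begin

definition mat_trace :: "'a :: comm_monoid_add mat \<Rightarrow> 'a" where
  "mat_trace A = (\<Sum>i<dim_row A. A $$ (i, i))"

definition unitary_mat :: "nat \<Rightarrow> complex mat \<Rightarrow> bool" where
  "unitary_mat n U \<longleftrightarrow>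
     U \<in> carrier_mat n n \<and> mat_adjoint U * U = 1\<^sub>m n \<and> U * mat_adjoint U = 1\<^sub>m n"

text \<open>The order on the complex numbers is that of \<^theory>\<open>HOL-Library.Complex_Order\<close>, so
  \<open>0 \<le> z\<close> says that \<open>z\<close> is real and nonnegative.\<close>

definition psd_mat :: "nat \<Rightarrow> complex mat \<Rightarrow> bool" where
  "psd_mat n A \<longleftrightarrow>
     A \<in> carrier_mat n n \<and> mat_adjoint A = A \<and>
     (\<forall>v \<in> carrier_vec n. 0 \<le> (A *\<^sub>v v) \<bullet>c v)"

definition is_hermitian_fun :: "(real \<Rightarrow> real) \<Rightarrow> complex mat \<Rightarrow> complex mat \<Rightarrow> bool" where
  "is_hermitian_fun f A X \<longleftrightarrow>
     (\<exists>U d. unitary_mat (dim_row A) U \<and>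
        A = U * mat_diag (dim_row A) (\<lambda>i. complex_of_real (d i)) * mat_adjoint U \<and>
        X = U * mat_diag (dim_row A) (\<lambda>i. complex_of_real (f (d i))) * mat_adjoint U)"

text \<open>Functional calculus of a Hermitian matrix. The value does not depend on the
  diagonalization chosen, see \<open>is_hermitian_fun_unique\<close> below.\<close>

definition hermitian_fun :: "(real \<Rightarrow> real) \<Rightarrow> complex mat \<Rightarrow> complex mat" where
  "hermitian_fun f A = (THE X. is_hermitian_fun f A X)"

text \<open>Since \<open>0 powr p = 0\<close> also for \<open>p = 0\<close>, the convention \<open>X\<^sup>0 = I\<close> needs its own case.\<close>

definition psd_powr :: "complex mat \<Rightarrow> real \<Rightarrow> complex mat" where
  "psd_powr A p =
     (if p = 0 then 1\<^sub>m (dim_row A) else hermitian_fun (\<lambda>x. x powr p) A)"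

lemma adjoint_carrier:
  assumes "U \<in> carrier_mat n n"
  shows "mat_adjoint U \<in> carrier_mat n n"
  using assms unfolding mat_adjoint_def by (auto simp: mat_of_rows_def)

lemma is_hermitian_fun_unique:
  assumes "is_hermitian_fun f A X" and "is_hermitian_fun f A Y"
  shows "X = Y"
proof -
  define n where "n = dim_row A"
  define D :: "(nat \<Rightarrow> real) \<Rightarrow> complex mat"
    where "D d = mat_diag n (\<lambda>i. complex_of_real (d i))" for d
  have D: "D d \<in> carrier_mat n n" for d
    by (simp add: D_def)
  obtain U d where U: "unitary_mat n U" and AU: "A = U * D d * mat_adjoint U"
    and X: "X = U * D (\<lambda>i. f (d i)) * mat_adjoint U"
    using assms(1) unfolding is_hermitian_fun_def n_def D_def by blast
  obtain V e where V: "unitary_mat n V" and AV: "A = V * D e * mat_adjoint V"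
    and Y: "Y = V * D (\<lambda>i. f (e i)) * mat_adjoint V"
    using assms(2) unfolding is_hermitian_fun_def n_def D_def by blast
  have Uc: "U \<in> carrier_mat n n" and Ui: "mat_adjoint U * U = 1\<^sub>m n" "U * mat_adjoint U = 1\<^sub>m n"
    using U unfolding unitary_mat_def by auto
  have Vc: "V \<in> carrier_mat n n" and Vi: "mat_adjoint V * V = 1\<^sub>m n" "V * mat_adjoint V = 1\<^sub>m n"
    using V unfolding unitary_mat_def by auto
  note Ua = adjoint_carrier[OF Uc] and Va = adjoint_carrier[OF Vc]
  define W where "W = mat_adjoint U * V"
  have Wc: "W \<in> carrier_mat n n"
    unfolding W_def using Ua Vc by simp
  have left: "mat_adjoint U * (U * D g * mat_adjoint U) * V = D g * W" for g
  proof -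
    have "mat_adjoint U * (U * D g * mat_adjoint U) * V
        = (mat_adjoint U * U) * (D g * (mat_adjoint U * V))"
      using Ua Uc Vc D[of g] by (simp add: assoc_mult_mat[of _ n n _ n _ n])
    then show ?thesis
      using Ui D[of g] Wc by (simp add: W_def)
  qed
  have right: "mat_adjoint U * (V * D g * mat_adjoint V) * V = W * D g" for g
  proof -
    have "mat_adjoint U * (V * D g * mat_adjoint V) * V
        = (mat_adjoint U * V) * (D g * (mat_adjoint V * V))"
      using Ua Uc Vc Va D[of g] by (simp add: assoc_mult_mat[of _ n n _ n _ n])
    then show ?thesis
      using Vi D[of g] Wc by (simp add: W_def)
  qed
  have DW: "(D g * W) $$ (i, j) = complex_of_real (g i) * W $$ (i, j)"
    "(W * D g) $$ (i, j) = W $$ (i, j) * complex_of_real (g j)"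
    if "i < n" "j < n" for g i j
    using that Wc by (auto simp: D_def mat_diag_mult_left mat_diag_mult_right)
  have eq: "D d * W = W * D e"
    using left[of d] right[of e] AU AV by simp
  have "D (\<lambda>i. f (d i)) * W = W * D (\<lambda>i. f (e i))"
  proof (rule eq_matI)
    fix i j
    assume "i < dim_row (W * D (\<lambda>i. f (e i)))" and "j < dim_col (W * D (\<lambda>i. f (e i)))"
    then have ij: "i < n" "j < n"
      using Wc D[of "\<lambda>i. f (e i)"] by auto
    have "complex_of_real (d i) * W $$ (i, j) = W $$ (i, j) * complex_of_real (e j)"
      using DW[OF ij] eq by metis
    then have "W $$ (i, j) = 0 \<or> d i = e j"
      by auto
    then show "(D (\<lambda>i. f (d i)) * W) $$ (i, j) = (W * D (\<lambda>i. f (e i))) $$ (i, j)"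
      using DW[OF ij] by auto
  qed (use Wc D[of "\<lambda>i. f (d i)"] D[of "\<lambda>i. f (e i)"] in auto)
  then have XY: "mat_adjoint U * X * V = mat_adjoint U * Y * V"
    unfolding X Y left right .
  have Xc: "X \<in> carrier_mat n n"
    unfolding X by (rule mult_carrier_mat[OF mult_carrier_mat[OF Uc D] Ua])
  have Yc: "Y \<in> carrier_mat n n"
    unfolding Y by (rule mult_carrier_mat[OF mult_carrier_mat[OF Vc D] Va])
  have cancel: "U * (mat_adjoint U * Z * V) * mat_adjoint V = Z"
    if Z: "Z \<in> carrier_mat n n" for Z
  proof -
    have "U * (mat_adjoint U * Z * V) * mat_adjoint V
        = (U * mat_adjoint U) * (Z * (V * mat_adjoint V))"
      using Ua Uc Vc Va Z by (simp add: assoc_mult_mat[of _ n n _ n _ n])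
    also have "\<dots> = Z"
      unfolding Ui Vi using Z by simp
    finally show ?thesis .
  qed
  have "X = U * (mat_adjoint U * X * V) * mat_adjoint V"
    by (rule cancel[OF Xc, symmetric])
  also have "\<dots> = U * (mat_adjoint U * Y * V) * mat_adjoint V"
    by (simp only: XY)
  also have "\<dots> = Y"
    by (rule cancel[OF Yc])
  finally show ?thesis .
qed

end

theory Submission
  imports Defs
begin

text \<open>Diagonalizing \<open>A\<close> and \<open>B\<close> with eigenvalues \<open>a\<^sub>i\<close> and \<open>b\<^sub>j\<close>, the trace of \<open>f(A) g(B)\<close> is
  \<open>\<Sum>\<^sub>i\<^sub>j f(a\<^sub>i) g(b\<^sub>j) w\<^sub>i\<^sub>j\<close>, where the weights \<open>w\<^sub>i\<^sub>j \<ge> 0\<close> are the squared moduli of the inner products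
  of the eigenvectors. With \<open>Tr B\<^sup>2\<close> written as \<open>Tr A\<^sup>0 B\<^sup>2\<close>, this reduces the claim to scalars \<open>a, b \<ge> 0\<close>.
  There \<open>c = a\<^sup>\<nu> b\<^sup>1\<^sup>-\<^sup>\<nu>\<close> lies between \<open>a\<close> and \<open>b\<close>, and the difference of the two sides is
  \<open>(b - c) (b + c - 2 a)\<close>, whose factors have the same sign.\<close>

section \<open>The spectral theorem\<close>

lemma mat_adjoint_dim [simp]:
  "dim_row (mat_adjoint A) = dim_col A" "dim_col (mat_adjoint A) = dim_row A"
  by (auto simp: mat_adjoint_def mat_of_rows_def)

lemma mat_adjoint_index [simp]:
  fixes A :: "complex mat"
  assumes "i < dim_col A" and "j < dim_row A"
  shows "mat_adjoint A $$ (i, j) = cnj (A $$ (j, i))"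
  using assms by (auto simp: mat_adjoint_def mat_of_rows_def)

lemma mat_adjoint_adjoint [simp]:
  fixes A :: "complex mat"
  shows "mat_adjoint (mat_adjoint A) = A"
  by (rule eq_matI) auto

lemma mat_adjoint_mult:
  fixes A B :: "complex mat"
  assumes "dim_col A = dim_row B"
  shows "mat_adjoint (A * B) = mat_adjoint B * mat_adjoint A"
  by (rule eq_matI) (use assms in \<open>auto simp: scalar_prod_def mult.commute\<close>)

lemma mat_adjoint_one [simp]: "mat_adjoint (1\<^sub>m n) = (1\<^sub>m n :: complex mat)"
  by (rule eq_matI) auto

lemma mat_adjoint_block_diagonal:
  fixes A D :: "complex mat"
  assumes "A \<in> carrier_mat m m" and "D \<in> carrier_mat n n"
  shows "mat_adjoint (four_block_mat A (0\<^sub>m m n) (0\<^sub>m n m) D) =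
    four_block_mat (mat_adjoint A) (0\<^sub>m m n) (0\<^sub>m n m) (mat_adjoint D)"
  by (rule eq_matI) (use assms in auto)

text \<open>For square matrices a left inverse is also a right inverse, so one of the two identities
  in \<open>unitary_mat\<close> suffices.\<close>

lemma unitary_matI:
  assumes "U \<in> carrier_mat n n" and "mat_adjoint U * U = 1\<^sub>m n"
  shows "unitary_mat n U"
  using assms adjoint_carrier[OF assms(1)] mat_mult_left_right_inverse[of "mat_adjoint U" n U]
  by (auto simp: unitary_mat_def)

lemma unitary_mat_mult:
  assumes "unitary_mat n U" and "unitary_mat n V"
  shows "unitary_mat n (U * V)"
proof (rule unitary_matI)
  have U: "U \<in> carrier_mat n n" "mat_adjoint U * U = 1\<^sub>m n"
    and V: "V \<in> carrier_mat n n" "mat_adjoint V * V = 1\<^sub>m n"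
    using assms by (auto simp: unitary_mat_def)
  note a = adjoint_carrier[OF U(1)] adjoint_carrier[OF V(1)]
  show "U * V \<in> carrier_mat n n"
    using U V by simp
  have "mat_adjoint (U * V) * (U * V) = mat_adjoint V * ((mat_adjoint U * U) * V)"
    using U(1) V(1) a by (simp add: mat_adjoint_mult assoc_mult_mat[of _ n n _ n _ n])
  then show "mat_adjoint (U * V) * (U * V) = 1\<^sub>m n"
    using U V by simp
qed

text \<open>Lifts a unitary that diagonalizes the lower block to the full size in the induction step
  of \<open>hermitian_diagonalization\<close>.\<close>

lemma unitary_mat_four_block:
  assumes "unitary_mat n U"
  shows "unitary_mat (Suc n) (four_block_mat (1\<^sub>m 1) (0\<^sub>m 1 n) (0\<^sub>m n 1) U)"
proof (rule unitary_matI)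
  have U: "U \<in> carrier_mat n n" "mat_adjoint U * U = 1\<^sub>m n"
    using assms by (auto simp: unitary_mat_def)
  note a = adjoint_carrier[OF U(1)]
  let ?F = "four_block_mat (1\<^sub>m 1) (0\<^sub>m 1 n) (0\<^sub>m n 1) U"
  show "?F \<in> carrier_mat (Suc n) (Suc n)"
    using four_block_carrier_mat[of "1\<^sub>m 1" 1 1 U n n] U by simp
  have "mat_adjoint ?F = four_block_mat (1\<^sub>m 1) (0\<^sub>m 1 n) (0\<^sub>m n 1) (mat_adjoint U)"
    unfolding mat_adjoint_block_diagonal[OF one_carrier_mat U(1)] mat_adjoint_one ..
  also have "\<dots> * ?F = four_block_mat (1\<^sub>m 1) (0\<^sub>m 1 n) (0\<^sub>m n 1) (1\<^sub>m n)"
    using U a by (subst mult_four_block_mat[of _ 1 1 _ n _ n _ _ 1 _ n]) auto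
  finally show "mat_adjoint ?F * ?F = 1\<^sub>m (Suc n)"
    by simp
qed

section \<open>Unitary diagonalization of Hermitian and positive semidefinite matrices\<close>

text \<open>Gram-Schmidt keeps the first vector of a basis that starts with \<open>v\<close>.
  Normalizing the resulting orthogonal vectors gives the columns of \<open>W\<close>; the scalar
  \<open>c\<close> is the normalization of \<open>v\<close>.\<close>

lemma unitary_completion:
  fixes v :: "complex vec"
  assumes v: "v \<in> carrier_vec n" and v0: "v \<noteq> 0\<^sub>v n"
  shows "\<exists>W c. unitary_mat n W \<and> col W 0 = c \<cdot>\<^sub>v v"
proof -
  interpret cof_vec_space n "TYPE(complex)" .
  define b where "b = basis_completion v"
  define ws where "ws = gram_schmidt n b"
  from basis_completion[OF v v0, folded b_def]
  have dist_b: "distinct b" and indep: "\<not> lin_dep (set b)" and b: "set b \<subseteq> carrier_vec n"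
    and hdb: "hd b = v" and len_b: "length b = n"
    by auto
  have n: "n > 0"
    using v v0 by (cases n) auto
  from gram_schmidt_result[OF b dist_b indep refl, folded ws_def]
  have ws: "set ws \<subseteq> carrier_vec n" "corthogonal ws" "length ws = n"
    by (auto simp: len_b)
  obtain vs where bv: "b = v # vs"
    using hdb len_b n by (cases b) auto
  have "hd ws = v"
    using gram_schmidt_hd[OF v, of vs] bv ws_def by simp
  then have ws0: "ws ! 0 = v"
    using ws n by (cases ws) auto
  have wsi: "ws ! i \<in> carrier_vec n" if "i < n" for i
    using ws that by auto
  \<comment> \<open>The output of \<open>gram_schmidt\<close> is orthogonal but not normalized, so
    the norms \<open>r i\<close> have to be divided out. They are nonzero because
    \<open>corthogonal\<close> also excludes vanishing vectors.\<close>
  define r where "r i = sqrt (Re (ws ! i \<bullet>c ws ! i))" for i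
  have pos: "ws ! i \<bullet>c ws ! i = complex_of_real (r i * r i)" "r i \<noteq> 0" if "i < n" for i
  proof -
    have "ws ! i \<bullet>c ws ! i \<noteq> 0"
      using corthogonalD[OF ws(2), of i i] that ws(3) by simp
    moreover have "ws ! i \<bullet>c ws ! i \<ge> 0"
      by (rule conjugate_square_ge_0_vec)
    ultimately have "Re (ws ! i \<bullet>c ws ! i) > 0" "Im (ws ! i \<bullet>c ws ! i) = 0"
      by (auto simp: less_eq_complex_def complex_eq_iff)
    then show "ws ! i \<bullet>c ws ! i = complex_of_real (r i * r i)" "r i \<noteq> 0"
      by (auto simp: r_def complex_eq_iff)
  qed
  define W where "W = mat n n (\<lambda>(i, j). ws ! j $ i / complex_of_real (r j))"
  have "unitary_mat n W"
  proof (rule unitary_matI)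
    show W: "W \<in> carrier_mat n n"
      by (simp add: W_def)
    show "mat_adjoint W * W = 1\<^sub>m n"
    proof (rule eq_matI)
      fix i j
      assume "i < dim_row (1\<^sub>m n :: complex mat)" "j < dim_col (1\<^sub>m n :: complex mat)"
      then have ij: "i < n" "j < n"
        by auto
      have "(mat_adjoint W * W) $$ (i, j)
          = (\<Sum>k = 0..<n. cnj (ws ! i $ k / complex_of_real (r i)) * (ws ! j $ k / complex_of_real (r j)))"
        using ij W by (simp add: scalar_prod_def) (simp add: W_def)
      also have "\<dots> = (\<Sum>k = 0..<n. ws ! j $ k * cnj (ws ! i $ k))
          / (complex_of_real (r i) * complex_of_real (r j))"
        unfolding sum_divide_distrib by (intro sum.cong) (auto simp: field_simps)
      also have "(\<Sum>k = 0..<n. ws ! j $ k * cnj (ws ! i $ k)) = ws ! j \<bullet>c ws ! i"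
        using wsi[OF ij(1)] wsi[OF ij(2)] by (auto simp: scalar_prod_def intro!: sum.cong)
      also have "\<dots> / (complex_of_real (r i) * complex_of_real (r j)) = 1\<^sub>m n $$ (i, j)"
        using ij pos[OF ij(1)] corthogonalD[OF ws(2), of j i] ws(3) by (cases "i = j") auto
      finally show "(mat_adjoint W * W) $$ (i, j) = 1\<^sub>m n $$ (i, j)" .
    qed (use W in auto)
  qed
  moreover have "col W 0 = (1 / complex_of_real (r 0)) \<cdot>\<^sub>v v"
    by (rule eq_vecI) (use n v in \<open>auto simp: W_def ws0\<close>)
  ultimately show ?thesis
    by blast
qed

text \<open>The characteristic polynomial has degree \<open>n > 0\<close>, so it has a complex root,
  which is an eigenvalue.\<close>

lemma complex_eigenvector_exists:
  fixes A :: "complex mat"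
  assumes A: "A \<in> carrier_mat n n" and "n > 0"
  shows "\<exists>v e. v \<in> carrier_vec n \<and> v \<noteq> 0\<^sub>v n \<and> A *\<^sub>v v = e \<cdot>\<^sub>v v"
proof -
  have "degree (char_poly A) = n"
    using degree_monic_char_poly[OF A] by simp
  then have "\<not> constant (poly (char_poly A))"
    using assms by (simp add: constant_degree)
  then obtain e where "poly (char_poly A) e = 0"
    using fundamental_theorem_of_algebra by blast
  then have "eigenvalue A e"
    using eigenvalue_root_char_poly[OF A] by simp
  then show ?thesis
    using A by (auto simp: eigenvalue_def eigenvector_def)
qed

text \<open>Induction on the size. Conjugation by a unitary whose first column is an eigenvector
  clears the first column below the diagonal, and Hermitian symmetry clears the first row as well.
  The remaining block is Hermitian and falls under the induction hypothesis.\<close>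

theorem hermitian_diagonalization:
  assumes "A \<in> carrier_mat n n" and "mat_adjoint A = A"
  shows "\<exists>U d. unitary_mat n U \<and>
    A = U * mat_diag n (\<lambda>i. complex_of_real (d i)) * mat_adjoint U"
  using assms
proof (induction n arbitrary: A)
  case 0
  have "unitary_mat 0 (1\<^sub>m 0)"
    by (rule unitary_matI) (auto intro!: eq_matI)
  moreover have "A = 1\<^sub>m 0 * mat_diag 0 (\<lambda>i. complex_of_real 0) * mat_adjoint (1\<^sub>m 0)"
    using 0 by (intro eq_matI) auto
  ultimately show ?case
    by (intro exI[of _ "1\<^sub>m 0"] exI[of _ "\<lambda>_. 0"]) simp
next
  case (Suc n A)
  let ?N = "Suc n"
  note A = Suc.prems(1)
  obtain v e where v: "v \<in> carrier_vec ?N" "v \<noteq> 0\<^sub>v ?N" "A *\<^sub>v v = e \<cdot>\<^sub>v v"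
    using complex_eigenvector_exists[OF A] by auto
  obtain W c where W: "unitary_mat ?N W" and W0: "col W 0 = c \<cdot>\<^sub>v v"
    using unitary_completion[OF v(1,2)] by blast
  have Wc: "W \<in> carrier_mat ?N ?N" and Wi: "mat_adjoint W * W = 1\<^sub>m ?N" "W * mat_adjoint W = 1\<^sub>m ?N"
    using W by (auto simp: unitary_mat_def)
  note Wa = adjoint_carrier[OF Wc]
  define H where "H = mat_adjoint W * (A * W)"
  have H: "H \<in> carrier_mat ?N ?N"
    using A Wc Wa by (simp add: H_def)
  have Hadj: "mat_adjoint H = H"
    using A Wc Wa Suc.prems(2)
    by (simp add: H_def mat_adjoint_mult assoc_mult_mat[of _ ?N ?N _ ?N _ ?N])
  \<comment> \<open>The first column of \<open>A * W\<close> is \<open>e\<close> times that of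
    \<open>W\<close>, so the first column of \<open>H\<close> is \<open>e\<close> times the first
    column of \<open>mat_adjoint W * W\<close>, the identity.\<close>
  have col0: "H $$ (i, 0) = (if i = 0 then e else 0)" if "i < ?N" for i
  proof -
    have "col (A * W) 0 = A *\<^sub>v col W 0"
      using A Wc by (intro col_mult2) auto
    also have "\<dots> = e \<cdot>\<^sub>v col W 0"
      using A v unfolding W0 by (simp add: mult_mat_vec smult_smult_assoc mult.commute)
    finally have c0: "col (A * W) 0 = e \<cdot>\<^sub>v col W 0" .
    have "H $$ (i, 0) = row (mat_adjoint W) i \<bullet> col (A * W) 0"
      using that A Wc Wa by (simp add: H_def)
    also have "\<dots> = e * (row (mat_adjoint W) i \<bullet> col W 0)"
      unfolding c0 using that Wc Wa by (simp add: scalar_prod_smult_distrib[of _ ?N])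
    also have "row (mat_adjoint W) i \<bullet> col W 0 = (mat_adjoint W * W) $$ (i, 0)"
      using that Wc by simp
    finally show ?thesis
      using that Wi by simp
  qed
  have herm: "H $$ (i, j) = cnj (H $$ (j, i))" if "i < ?N" "j < ?N" for i j
    using mat_adjoint_index[of i H j] H that Hadj by simp
  define H' where "H' = mat n n (\<lambda>(i, j). H $$ (Suc i, Suc j))"
  have H': "H' \<in> carrier_mat n n"
    by (simp add: H'_def)
  have "mat_adjoint H' = H'"
    by (rule eq_matI) (auto simp: H'_def simp flip: herm)
  then obtain U d where U: "unitary_mat n U"
    and HU: "H' = U * mat_diag n (\<lambda>i. complex_of_real (d i)) * mat_adjoint U"
    using Suc.IH[OF H'] by blast
  have Uc: "U \<in> carrier_mat n n"
    using U by (simp add: unitary_mat_def)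
  note Ua = adjoint_carrier[OF Uc]
  define D where "D = mat_diag n (\<lambda>i. complex_of_real (d i))"
  have Dc: "D \<in> carrier_mat n n"
    by (simp add: D_def)
  define F where "F = four_block_mat (1\<^sub>m 1) (0\<^sub>m 1 n) (0\<^sub>m n 1) U"
  \<comment> \<open>The new eigenvalue takes index 0 and the old ones move up by one. Taking
    \<open>Re e\<close> loses nothing: \<open>e\<close> is a diagonal entry of the Hermitian matrix
    \<open>H\<close>, hence real.\<close>
  define d' where "d' i = (case i of 0 \<Rightarrow> Re e | Suc k \<Rightarrow> d k)" for i
  define D' where "D' = mat_diag ?N (\<lambda>i. complex_of_real (d' i))"
  have D'c: "D' \<in> carrier_mat ?N ?N"
    by (simp add: D'_def)
  define E where "E = mat 1 1 (\<lambda>_. e)"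
  have Ec: "E \<in> carrier_mat 1 1"
    by (simp add: E_def)
  have e: "complex_of_real (Re e) = e"
    using herm[of 0 0] col0[of 0] by (simp add: complex_eq_iff)
  have D': "D' = four_block_mat E (0\<^sub>m 1 n) (0\<^sub>m n 1) D"
    by (rule eq_matI) (auto simp: D'_def D_def E_def mat_diag_def d'_def e split: nat.splits)
  have Fa: "mat_adjoint F = four_block_mat (1\<^sub>m 1) (0\<^sub>m 1 n) (0\<^sub>m n 1) (mat_adjoint U)"
    unfolding F_def mat_adjoint_block_diagonal[OF one_carrier_mat Uc] mat_adjoint_one ..
  have "F * D' = four_block_mat E (0\<^sub>m 1 n) (0\<^sub>m n 1) (U * D)"
    unfolding F_def D' using Uc Dc Ec by (subst mult_four_block_mat[of _ 1 1 _ n _ n _ _ 1 _ n]) auto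
  also have "\<dots> * mat_adjoint F = four_block_mat E (0\<^sub>m 1 n) (0\<^sub>m n 1) H'"
    unfolding Fa HU D_def[symmetric] using Uc Dc Ec Ua
    by (subst mult_four_block_mat[of _ 1 1 _ n _ n _ _ 1 _ n]) auto
  also have "\<dots> = H"
  proof (rule eq_matI)
    fix i j
    assume "i < dim_row H" "j < dim_col H"
    then have ij: "i < ?N" "j < ?N"
      using H by auto
    then show "four_block_mat E (0\<^sub>m 1 n) (0\<^sub>m n 1) H' $$ (i, j) = H $$ (i, j)"
      using col0[of i] col0[of j] herm[of i j] by (cases i; cases j) (auto simp: E_def H'_def)
  qed (use H H' Ec in auto)
  finally have HF: "H = F * D' * mat_adjoint F" ..
  have Fu: "unitary_mat ?N F"
    unfolding F_def by (rule unitary_mat_four_block[OF U])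
  then have Fc: "F \<in> carrier_mat ?N ?N"
    by (simp add: unitary_mat_def)
  note Fac = adjoint_carrier[OF Fc]
  have "A = (W * mat_adjoint W) * (A * (W * mat_adjoint W))"
    using A unfolding Wi by simp
  also have "\<dots> = W * H * mat_adjoint W"
    using A Wc Wa by (simp add: H_def assoc_mult_mat[of _ ?N ?N _ ?N _ ?N])
  also have "\<dots> = (W * F) * D' * mat_adjoint (W * F)"
    using A Wc Wa Fc Fac D'c by (simp add: HF mat_adjoint_mult assoc_mult_mat[of _ ?N ?N _ ?N _ ?N])
  finally show ?case
    using unitary_mat_mult[OF W Fu] unfolding D'_def by blast
qed

text \<open>Each eigenvalue \<open>d i\<close> is the value of the quadratic form of
  \<open>A\<close> at the \<open>i\<close>-th column of \<open>U\<close>, hence nonnegative.\<close>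

lemma psd_diagonalization:
  assumes "psd_mat n A"
  shows "\<exists>U d. unitary_mat n U \<and> (\<forall>i<n. 0 \<le> d i) \<and>
    A = U * mat_diag n (\<lambda>i. complex_of_real (d i)) * mat_adjoint U"
proof -
  have A: "A \<in> carrier_mat n n" "mat_adjoint A = A"
    and pos: "\<And>v. v \<in> carrier_vec n \<Longrightarrow> 0 \<le> (A *\<^sub>v v) \<bullet>c v"
    using assms by (auto simp: psd_mat_def)
  obtain U d where U: "unitary_mat n U"
    and AU: "A = U * mat_diag n (\<lambda>i. complex_of_real (d i)) * mat_adjoint U"
    using hermitian_diagonalization[OF A] by blast
  define D where "D = mat_diag n (\<lambda>i. complex_of_real (d i))"
  have Dc: "D \<in> carrier_mat n n"
    by (simp add: D_def)
  have Uc: "U \<in> carrier_mat n n" and Ui: "mat_adjoint U * U = 1\<^sub>m n"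
    using U by (auto simp: unitary_mat_def)
  note Ua = adjoint_carrier[OF Uc]
  have "mat_adjoint U * (A * U) = (mat_adjoint U * U) * (D * (mat_adjoint U * U))"
    unfolding AU D_def[symmetric] using Uc Ua Dc by (simp add: assoc_mult_mat[of _ n n _ n _ n])
  then have D: "mat_adjoint U * (A * U) = D"
    using Dc by (simp add: Ui)
  have "0 \<le> d i" if i: "i < n" for i
  proof -
    let ?u = "col U i"
    have "D $$ (i, i) = row (mat_adjoint U) i \<bullet> (A *\<^sub>v ?u)"
      using i A Uc Ua by (simp add: mult_mat_vec_def flip: D)
    also have "row (mat_adjoint U) i = conjugate ?u"
      by (rule eq_vecI) (use i Uc in auto)
    also have "conjugate ?u \<bullet> (A *\<^sub>v ?u) = (A *\<^sub>v ?u) \<bullet>c ?u"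
      using i A Uc by (intro comm_scalar_prod[of _ n]) auto
    finally have "0 \<le> D $$ (i, i)"
      using pos[of ?u] Uc i by simp
    then show ?thesis
      using i by (simp add: D_def mat_diag_def less_eq_complex_def)
  qed
  then show ?thesis
    using U AU by blast
qed

section \<open>Traces of functions of two matrices\<close>

text \<open>Uniqueness resolves the definite description, so any diagonalization at hand may be used
  to compute the functional calculus.\<close>

lemma hermitian_fun_eq:
  assumes "unitary_mat n U"
    and "A = U * mat_diag n (\<lambda>i. complex_of_real (d i)) * mat_adjoint U"
  shows "hermitian_fun f A = U * mat_diag n (\<lambda>i. complex_of_real (f (d i))) * mat_adjoint U"
proof -
  have "dim_row A = n"
    using assms by (auto simp: unitary_mat_def)
  then have "is_hermitian_fun f A (U * mat_diag n (\<lambda>i. complex_of_real (f (d i))) * mat_adjoint U)"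
    using assms unfolding is_hermitian_fun_def by blast
  then show ?thesis
    unfolding hermitian_fun_def using is_hermitian_fun_unique by blast
qed

text \<open>The scalar counterpart of \<open>psd_powr\<close>: \<open>rpow 0 0 = 1\<close>, whereas
  \<open>0 powr 0 = 0\<close>.\<close>

definition rpow :: "real \<Rightarrow> real \<Rightarrow> real" where
  "rpow x p = (if p = 0 then 1 else x powr p)"

text \<open>At exponent 0 the diagonal factor is the identity and the product collapses to
  \<open>U * mat_adjoint U\<close>, so one formula covers both cases of
  \<open>psd_powr\<close>.\<close>

lemma psd_powr_eq:
  assumes U: "unitary_mat n U"
    and A: "A = U * mat_diag n (\<lambda>i. complex_of_real (d i)) * mat_adjoint U"
  shows "psd_powr A p = U * mat_diag n (\<lambda>i. complex_of_real (rpow (d i) p)) * mat_adjoint U"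
proof (cases "p = 0")
  case True
  have "dim_row A = n"
    using assms by (auto simp: unitary_mat_def)
  then show ?thesis
    using True U by (auto simp: psd_powr_def rpow_def unitary_mat_def)
next
  case False
  then show ?thesis
    using hermitian_fun_eq[OF assms, of "\<lambda>x. x powr p"] by (simp add: psd_powr_def rpow_def)
qed

section \<open>Trace of a product as a double sum over eigenvalues\<close>

lemma diagonalized_index:
  assumes "U \<in> carrier_mat n n" and "k < n" and "l < n"
  shows "(U * mat_diag n f * mat_adjoint U) $$ (k, l) = (\<Sum>i<n. U $$ (k, i) * f i * cnj (U $$ (l, i)))"
  using assms
  by (simp add: mat_diag_mult_right[OF assms(1)] scalar_prod_def atLeast0LessThan)

lemma mat_trace_mult:
  fixes X Y :: "'a :: semiring_0 mat"
  assumes "X \<in> carrier_mat n n" and "Y \<in> carrier_mat n n"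
  shows "mat_trace (X * Y) = (\<Sum>k<n. \<Sum>l<n. X $$ (k, l) * Y $$ (l, k))"
  using assms by (simp add: mat_trace_def scalar_prod_def atLeast0LessThan)

text \<open>For fixed \<open>i\<close> and \<open>j\<close>, the sums over the matrix indices
  \<open>k\<close> and \<open>l\<close> factor into a complex number times its conjugate. That
  number is the inner product of column \<open>i\<close> of \<open>U\<close> with column
  \<open>j\<close> of \<open>V\<close>.\<close>

lemma trace_mult_diagonalized:
  assumes U: "unitary_mat n U" and V: "unitary_mat n V"
  shows "mat_trace ((U * mat_diag n (\<lambda>i. complex_of_real (f i)) * mat_adjoint U) *
      (V * mat_diag n (\<lambda>j. complex_of_real (g j)) * mat_adjoint V)) =
    complex_of_real (\<Sum>i<n. \<Sum>j<n. f i * g j * (cmod (\<Sum>k<n. U $$ (k, i) * cnj (V $$ (k, j))))\<^sup>2)"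
    (is "mat_trace (?X * ?Y) = _")
proof -
  have Uc: "U \<in> carrier_mat n n" and Vc: "V \<in> carrier_mat n n"
    using assms by (auto simp: unitary_mat_def)
  have X: "?X \<in> carrier_mat n n"
    by (rule mult_carrier_mat[OF mult_carrier_mat[OF Uc mat_diag_dim] adjoint_carrier[OF Uc]])
  have Y: "?Y \<in> carrier_mat n n"
    by (rule mult_carrier_mat[OF mult_carrier_mat[OF Vc mat_diag_dim] adjoint_carrier[OF Vc]])
  have "mat_trace (?X * ?Y) = (\<Sum>k<n. \<Sum>l<n. ?X $$ (k, l) * ?Y $$ (l, k))"
    by (rule mat_trace_mult[OF X Y])
  also have "\<dots> = (\<Sum>k<n. \<Sum>l<n. (\<Sum>i<n. U $$ (k, i) * complex_of_real (f i) * cnj (U $$ (l, i))) *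
      (\<Sum>j<n. V $$ (l, j) * complex_of_real (g j) * cnj (V $$ (k, j))))"
    by (intro sum.cong refl) (simp add: diagonalized_index[OF Uc] diagonalized_index[OF Vc])
  also have "\<dots> = (\<Sum>k<n. \<Sum>l<n. \<Sum>i<n. \<Sum>j<n. complex_of_real (f i * g j) *
      ((U $$ (k, i) * cnj (V $$ (k, j))) * cnj (U $$ (l, i) * cnj (V $$ (l, j)))))"
    by (simp add: sum_product mult_ac)
  \<comment> \<open>The exchanges from here on move \<open>i\<close> and \<open>j\<close> outside
    \<open>k\<close> and \<open>l\<close>, where the factorization becomes visible.\<close>
  also have "\<dots> = (\<Sum>k<n. \<Sum>i<n. \<Sum>l<n. \<Sum>j<n. complex_of_real (f i * g j) *
      ((U $$ (k, i) * cnj (V $$ (k, j))) * cnj (U $$ (l, i) * cnj (V $$ (l, j)))))"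
    by (rule sum.cong[OF refl], rule sum.swap)
  also have "\<dots> = (\<Sum>i<n. \<Sum>k<n. \<Sum>j<n. \<Sum>l<n. complex_of_real (f i * g j) *
      ((U $$ (k, i) * cnj (V $$ (k, j))) * cnj (U $$ (l, i) * cnj (V $$ (l, j)))))"
    by (rule trans[OF sum.swap], rule sum.cong[OF refl], rule sum.cong[OF refl], rule sum.swap)
  also have "\<dots> = (\<Sum>i<n. \<Sum>j<n. \<Sum>k<n. \<Sum>l<n. complex_of_real (f i * g j) *
      ((U $$ (k, i) * cnj (V $$ (k, j))) * cnj (U $$ (l, i) * cnj (V $$ (l, j)))))"
    by (rule sum.cong[OF refl], rule sum.swap)
  also have "\<dots> = (\<Sum>i<n. \<Sum>j<n. complex_of_real (f i * g j) *
      ((\<Sum>k<n. U $$ (k, i) * cnj (V $$ (k, j))) * cnj (\<Sum>l<n. U $$ (l, i) * cnj (V $$ (l, j)))))"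
    by (simp only: cnj_sum sum_product) (simp only: sum_distrib_left)
  finally show ?thesis
    by (simp only: complex_norm_square[symmetric] of_real_sum of_real_mult of_real_power)
qed

section \<open>The scalar inequality\<close>

lemma rpow_simps [simp]:
  "rpow x 0 = 1" "0 \<le> x \<Longrightarrow> rpow x 1 = x" "0 \<le> x \<Longrightarrow> rpow x 2 = x\<^sup>2"
  by (auto simp: rpow_def powr_numeral)

lemma rpow_nonneg: "0 \<le> x \<Longrightarrow> 0 \<le> rpow x p"
  by (simp add: rpow_def)

text \<open>The sign conditions exclude opposite nonzero exponents, for which the law fails at
  \<open>x = 0\<close> because \<open>rpow 0 0 = 1\<close>.\<close>

lemma rpow_add: "0 \<le> p \<Longrightarrow> 0 \<le> q \<Longrightarrow> rpow x (p + q) = rpow x p * rpow x q"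
  by (auto simp: rpow_def powr_add)

lemma rpow_mono: "0 \<le> p \<Longrightarrow> 0 \<le> x \<Longrightarrow> x \<le> y \<Longrightarrow> rpow x p \<le> rpow y p"
  by (auto simp: rpow_def intro: powr_mono2)

text \<open>Stated with \<open>rpow\<close>, so that zero eigenvalues at the endpoints \<nu> = 0 and
  \<nu> = 1 follow the same convention as the matrix powers.\<close>

lemma scalar_power_inequality:
  fixes a b \<nu> :: real
  assumes "0 \<le> a" "0 \<le> b" "0 \<le> \<nu>" "\<nu> \<le> 1"
  shows "rpow a (2 * \<nu>) * rpow b (2 * (1 - \<nu>)) + 2 * (a * b)
    \<le> b\<^sup>2 + 2 * (rpow a (1 + \<nu>) * rpow b (1 - \<nu>))"
proof -
  define c where "c = rpow a \<nu> * rpow b (1 - \<nu>)"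
  \<comment> \<open>Splits \<open>a\<close> and \<open>b\<close> in the same way as
    \<open>c\<close>: then \<open>c\<close> differs from each of them in a single factor, and
    monotonicity of \<open>rpow\<close> in the base compares them.\<close>
  have diag: "rpow x \<nu> * rpow x (1 - \<nu>) = x" if "0 \<le> x" for x
    using rpow_add[of \<nu> "1 - \<nu>" x] assms that by simp
  have sq: "rpow a (2 * \<nu>) * rpow b (2 * (1 - \<nu>)) = c\<^sup>2"
    using rpow_add[of \<nu> \<nu> a] rpow_add[of "1 - \<nu>" "1 - \<nu>" b] assms
    unfolding c_def mult_2 by (simp add: power2_eq_square mult_ac)
  have ac: "rpow a (1 + \<nu>) * rpow b (1 - \<nu>) = a * c"
    using rpow_add[of 1 \<nu> a] assms by (simp add: c_def)
  have "0 \<le> (b - c) * (b + c - 2 * a)"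
  proof (cases "a \<le> b")
    case True
    have "a \<le> c"
      using mult_left_mono[OF rpow_mono[of "1 - \<nu>" a b] rpow_nonneg[of a \<nu>]] True assms diag[of a]
      by (simp add: c_def)
    moreover have "c \<le> b"
      using mult_right_mono[OF rpow_mono[of \<nu> a b] rpow_nonneg[of b "1 - \<nu>"]] True assms diag[of b]
      by (simp add: c_def)
    ultimately show ?thesis
      using True by (intro mult_nonneg_nonneg) auto
  next
    case False
    then have "b \<le> a"
      by simp
    have "c \<le> a"
      using mult_left_mono[OF rpow_mono[of "1 - \<nu>" b a] rpow_nonneg[of a \<nu>]] \<open>b \<le> a\<close> assms diag[of a]
      by (simp add: c_def)
    moreover have "b \<le> c"
      using mult_right_mono[OF rpow_mono[of \<nu> b a] rpow_nonneg[of b "1 - \<nu>"]] \<open>b \<le> a\<close> assms diag[of b]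
      by (simp add: c_def)
    ultimately show ?thesis
      using \<open>b \<le> a\<close> by (intro mult_nonpos_nonpos) auto
  qed
  then show ?thesis
    unfolding sq ac by (simp add: algebra_simps power2_eq_square)
qed

section \<open>Summing the scalar inequality over pairs of eigenvalues\<close>

theorem theorem4:
  fixes A B :: "complex mat" and n :: nat and \<nu> :: real
  assumes "psd_mat n A" and "psd_mat n B"
    and "0 \<le> \<nu>" and "\<nu> \<le> 1"
  shows "mat_trace (psd_powr B 2) + 2 * mat_trace (psd_powr A (1 + \<nu>) * psd_powr B (1 - \<nu>))
    \<ge> mat_trace (psd_powr A (2 * \<nu>) * psd_powr B (2 * (1 - \<nu>))) + 2 * mat_trace (A * B)"
proof -
  obtain U a where U: "unitary_mat n U" and a: "\<And>i. i < n \<Longrightarrow> 0 \<le> a i"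
    and AU: "A = U * mat_diag n (\<lambda>i. complex_of_real (a i)) * mat_adjoint U"
    using psd_diagonalization[OF assms(1)] by blast
  obtain V b where V: "unitary_mat n V" and b: "\<And>i. i < n \<Longrightarrow> 0 \<le> b i"
    and BV: "B = V * mat_diag n (\<lambda>i. complex_of_real (b i)) * mat_adjoint V"
    using psd_diagonalization[OF assms(2)] by blast
  define w where "w i j = (cmod (\<Sum>k<n. U $$ (k, i) * cnj (V $$ (k, j))))\<^sup>2" for i j
  have w: "0 \<le> w i j" for i j
    by (simp add: w_def)
  note PA = psd_powr_eq[OF U AU] and PB = psd_powr_eq[OF V BV]
  have tr: "mat_trace (psd_powr A p * psd_powr B q)
      = complex_of_real (\<Sum>i<n. \<Sum>j<n. rpow (a i) p * rpow (b j) q * w i j)" for p q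
    unfolding PA PB trace_mult_diagonalized[OF U V] w_def ..
  have AB: "mat_trace (A * B) = complex_of_real (\<Sum>i<n. \<Sum>j<n. a i * b j * w i j)"
    unfolding w_def trace_mult_diagonalized[OF U V, symmetric] AU[symmetric] BV[symmetric] ..
  have Bc: "B \<in> carrier_mat n n" "A \<in> carrier_mat n n"
    using assms by (auto simp: psd_mat_def)
  have "psd_powr B 2 \<in> carrier_mat n n"
    unfolding PB using V
    by (intro mult_carrier_mat[of _ n n] adjoint_carrier mat_diag_dim) (auto simp: unitary_mat_def)
  \<comment> \<open>Inserting the identity as a power of \<open>A\<close> expands this trace over
    the same weights \<open>w\<close> as the other three.\<close>
  then have "psd_powr B 2 = psd_powr A 0 * psd_powr B 2"
    using Bc by (simp add: psd_powr_def)
  then have BB: "mat_trace (psd_powr B 2) = complex_of_real (\<Sum>i<n. \<Sum>j<n. (b j)\<^sup>2 * w i j)"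
    using tr[of 0 2] b by simp
  have "(\<Sum>i<n. \<Sum>j<n. rpow (a i) (2 * \<nu>) * rpow (b j) (2 * (1 - \<nu>)) * w i j)
        + 2 * (\<Sum>i<n. \<Sum>j<n. a i * b j * w i j)
      = (\<Sum>i<n. \<Sum>j<n. (rpow (a i) (2 * \<nu>) * rpow (b j) (2 * (1 - \<nu>)) + 2 * (a i * b j)) * w i j)"
    by (simp add: sum.distrib sum_distrib_left distrib_right mult.assoc)
  also have "\<dots> \<le> (\<Sum>i<n. \<Sum>j<n. ((b j)\<^sup>2 + 2 * (rpow (a i) (1 + \<nu>) * rpow (b j) (1 - \<nu>))) * w i j)"
    using a b w assms
    by (intro sum_mono mult_right_mono scalar_power_inequality) auto
  also have "\<dots> = (\<Sum>i<n. \<Sum>j<n. (b j)\<^sup>2 * w i j)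
        + 2 * (\<Sum>i<n. \<Sum>j<n. rpow (a i) (1 + \<nu>) * rpow (b j) (1 - \<nu>) * w i j)"
    by (simp add: sum.distrib sum_distrib_left distrib_right mult.assoc)
  \<comment> \<open>All four traces are embedded real numbers, so the order on the complex numbers
    reduces to the real inequality just shown.\<close>
  finally show ?thesis
    unfolding tr AB BB by (simp add: less_eq_complex_def)
qed

end
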